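(* Let $1<p\le n$. Let $\mathbf{X}$ be a deterministic $n\times p$ matrix with $\mathbf{X}^T\mathbf{X}=\mathbf{I}_p$, let $\boldsymbol\beta_0=(\beta_1,0,\dots,0)^T\in\mathbb{R}^p$ with $\beta_1\neq 0$, let $\sigma>0$, and let $\mathbf{y}=\mathbf{X}\boldsymbol\beta_0+\boldsymbol\varepsilon$ with $\varepsilon_1,\dots,\varepsilon_n$ i.i.d. $N(0,\sigma^2)$. Set $\mathbf z=(z_1,\dots,z_p)^T=\mathbf{X}^T\mathbf{y}$. For $\lambda\ge 0$ define $$L_p(\lambda)=\frac1n\Big(\beta_1-\operatorname{sgn}(z_1)(|z_1|-\lambda)_+\Big)^2+\frac1n\sum_{j=2}^p\big((|z_j|-\lambda)_+\big)^2,\qquad L_1(\lambda)=\frac1n\Big(\beta_1-\operatorname{sgn}(z_1)(|z_1|-\lambda)_+\Big)^2,$$ and let $L_p(\lambda_p^* )=\min_{\lambda\ge0}L_p(\lambda)$ and $L_1(\lambda_1^* )=\min_{\lambda\ge 0}L_1(\lambda)$. Then $$\Pr\Big(L_p(\lambda_p^* )>L_1(\lambda_1^* )\Big)=\Phi\!\left(\frac{|\beta_1|}{\sigma}\right)-\frac{1}{2p},$$ where $\Phi$ is the standard normal cumulative distribution function. (The paper writes the event as $L_p(\lambda_p^* )/L_1(\lambda_1^* )>1$.)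
   Context: Here $(a)_+=\max(a,0)$ and $\operatorname{sgn}$ is the sign function. For $\lambda\ge0$, $\hat\beta_{\lambda j}=\operatorname{sgn}(z_j)(|z_j|-\lambda)_+$ is the Lasso estimate under the orthonormal design, so $L_p(\lambda)=\|\mathbf X\boldsymbol\beta_0-\mathbf X\hat{\boldsymbol\beta}_\lambda\|^2/n$ is the $L_2$ loss of the Lasso using all $p$ predictors, and $L_1(\lambda)$ is the loss of the Lasso using only the first (true) predictor. $\lambda_p^*$ denotes a minimizer of $L_p$ over $\lambda\in[0,\infty)$. *)

theory Defs
  imports "HOL-Probability.Probability"
begin

definition std_normal_cdf :: "real \<Rightarrow> real" where
  "std_normal_cdf = cdf (density lborel std_normal_density)"

text \<open>Positive part and soft-thresholding (Lasso estimate under orthonormal design).\<close>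
definition pos_part :: "real \<Rightarrow> real" where
  "pos_part a = max a 0"

definition soft_thr :: "real \<Rightarrow> real \<Rightarrow> real" where
  "soft_thr z lam = sgn z * pos_part (\<bar>z\<bar> - lam)"

text \<open>Losses; indices are 0-based, so z 0 is z_1 and j ranges over 1..p-1 for j = 2..p.\<close>
definition loss_p :: "nat \<Rightarrow> nat \<Rightarrow> real \<Rightarrow> (nat \<Rightarrow> real) \<Rightarrow> real \<Rightarrow> real" where
  "loss_p n p b1 z lam =
     (b1 - soft_thr (z 0) lam)\<^sup>2 / real n + (\<Sum>j\<in>{1..<p}. (pos_part (\<bar>z j\<bar> - lam))\<^sup>2) / real n"

definition loss_1 :: "nat \<Rightarrow> real \<Rightarrow> (nat \<Rightarrow> real) \<Rightarrow> real \<Rightarrow> real" where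
  "loss_1 n b1 z lam = (b1 - soft_thr (z 0) lam)\<^sup>2 / real n"

end

theory Submission
  imports Defs
begin

text \<open>
  Put \<open>b = \<bar>b1\<bar>\<close>, let \<open>W j\<close> be the noise part of \<open>z j\<close>, and \<open>D = sgn b1 * W 0\<close>. Soft-thresholding
  only shrinks. If \<open>D \<le> - b\<close>, the best one-variable fit is \<open>0\<close>, which thresholding everything away
  also attains. Otherwise the one-variable loss is minimal only at the threshold \<open>max D 0\<close>, and the
  full loss reaches the same value iff that threshold kills all other coordinates. So up to a null
  set the event is the difference of \<open>{- b < D}\<close>, of probability \<open>\<Phi>(b/\<sigma>)\<close>, and
  \<open>{\<forall>j<p. \<bar>W j\<bar> \<le> D}\<close>.

  The \<open>2p\<close> events \<open>{\<forall>j<p. \<bar>W j\<bar> \<le> s * W k}\<close> with \<open>s = \<plusminus>1\<close> cover the space and overlap in null sets.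
  They are equally likely because the reflection that exchanges column \<open>0\<close> with \<open>s\<close> times
  column \<open>k\<close> preserves the law of the noise; hence each has probability \<open>1/(2p)\<close>. Working with these
  reflections makes the joint law of the \<open>W j\<close> unnecessary.
\<close>

section \<open>Reflections preserve the Gaussian product measure\<close>

interpretation lborel_product: product_sigma_finite "\<lambda>_. lborel :: real measure" ..

text \<open>Integrate coordinate \<open>k\<close> innermost. With the other coordinates fixed,
  \<open>g\<close> is constant by \<open>indep\<close>, and what remains is an affine map of the
  line with slope of modulus 1.\<close>

lemma distr_PiM_lborel_shear:
  fixes I :: "'i set" and g :: "('i \<Rightarrow> real) \<Rightarrow> real"
  assumes "finite I" "k \<in> I" "\<bar>s\<bar> = 1"
    and g [measurable]: "g \<in> borel_measurable (PiM I (\<lambda>_. lborel))"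
    and indep: "\<And>x t. g (x(k := t)) = g x"
  shows "distr (PiM I (\<lambda>_. lborel)) (PiM I (\<lambda>_. lborel)) (\<lambda>x. x(k := s * x k + g x))
       = PiM I (\<lambda>_. lborel)"
proof (rule measure_eqI)
  let ?L = "PiM I (\<lambda>_. lborel) :: ('i \<Rightarrow> real) measure"
  let ?T = "\<lambda>x. x(k := s * x k + g x)"
  have [measurable]: "?T \<in> measurable ?L ?L"
    using assms(2) by (auto intro!: measurable_fun_upd[where J=I])
  define J where "J = I - {k}"
  have I: "I = insert k J" "k \<notin> J" "finite J"
    using assms by (auto simp: J_def)
  fix A assume "A \<in> sets (distr ?L ?L ?T)"
  then have [measurable]: "A \<in> sets ?L" by simp
  have ins [measurable]: "(\<lambda>y. x(k := y)) \<in> measurable borel ?L" if "x \<in> space (PiM J (\<lambda>_. lborel))" for x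
    using that I(1) by (intro measurable_fun_upd[where J=J]) auto
  have ind_A: "(indicator A :: _ \<Rightarrow> ennreal) \<in> borel_measurable ?L"
    by measurable
  have ind_T: "(\<lambda>x. indicator A (?T x) :: ennreal) \<in> borel_measurable ?L"
    by measurable
  have "emeasure (distr ?L ?L ?T) A = (\<integral>\<^sup>+ x. indicator A (?T x) \<partial>?L)"
    by (simp add: nn_integral_distr flip: nn_integral_indicator)
  also have "\<dots> = (\<integral>\<^sup>+ x. (\<integral>\<^sup>+ y. indicator A (?T (x(k := y))) \<partial>lborel) \<partial>PiM J (\<lambda>_. lborel))"
    using ind_T unfolding I(1) by (intro lborel_product.product_nn_integral_insert) (use I in simp_all)
  also have "\<dots> = (\<integral>\<^sup>+ x. (\<integral>\<^sup>+ y. indicator A (x(k := y)) \<partial>lborel) \<partial>PiM J (\<lambda>_. lborel))"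
  proof (rule nn_integral_cong)
    fix x :: "'i \<Rightarrow> real" assume x: "x \<in> space (PiM J (\<lambda>_. lborel))"
    note [measurable] = ins[OF x]
    have s: "s \<noteq> 0" using assms(3) by auto
    have "(\<integral>\<^sup>+ y. indicator A (x(k := y)) \<partial>lborel)
        = ennreal \<bar>s\<bar> * (\<integral>\<^sup>+ y. indicator A (x(k := g x + s * y)) \<partial>lborel)"
      by (rule nn_integral_real_affine[OF _ s]) measurable
    then show "(\<integral>\<^sup>+ y. indicator A (?T (x(k := y))) \<partial>lborel) = (\<integral>\<^sup>+ y. indicator A (x(k := y)) \<partial>lborel)"
      using assms(3) by (simp add: indep add.commute)
  qed
  also have "\<dots> = (\<integral>\<^sup>+ x. indicator A x \<partial>?L)"
    using ind_A unfolding I(1)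
    by (intro lborel_product.product_nn_integral_insert[symmetric]) (use I in simp_all)
  finally show "emeasure (distr ?L ?L ?T) A = emeasure ?L A" by simp
qed simp

text \<open>Induction on \<open>J\<close>: each new index composes with one shear of a single
  coordinate. Since \<open>k\<close> is not in \<open>J\<close>, the value \<open>x k\<close> that
  is fed in never changes.\<close>

lemma distr_PiM_lborel_multi_shear:
  fixes I :: "'i set" and c :: "'i \<Rightarrow> real"
  assumes "finite I" "k \<in> I" "J \<subseteq> I - {k}"
  shows "(\<lambda>x i. if i \<in> J then x i + c i * x k else x i)
           \<in> measurable (PiM I (\<lambda>_. lborel)) (PiM I (\<lambda>_. lborel)) \<and>
         distr (PiM I (\<lambda>_. lborel)) (PiM I (\<lambda>_. lborel))
           (\<lambda>x i. if i \<in> J then x i + c i * x k else x i) = PiM I (\<lambda>_. lborel)"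
proof -
  have "finite J" using assms by (meson finite_Diff finite_subset)
  then show ?thesis using assms(3)
  proof (induction J rule: finite_induct)
    case empty
    then show ?case by (simp add: distr_id)
  next
    case (insert j J)
    let ?L = "PiM I (\<lambda>_. lborel) :: ('i \<Rightarrow> real) measure"
    let ?A = "\<lambda>x i. if i \<in> J then x i + c i * x k else x i"
    let ?S = "\<lambda>x. x(j := 1 * x j + c j * x k)"
    have IH: "?A \<in> measurable ?L ?L" "distr ?L ?L ?A = ?L" using insert by auto
    have j: "j \<in> I" "j \<noteq> k" "k \<notin> J" "j \<notin> J" using insert by auto
    have [measurable]: "(\<lambda>x. c j * x k) \<in> borel_measurable ?L"
      using assms(2) by measurable
    have S: "?S \<in> measurable ?L ?L"
      using assms(2) j by (auto intro!: measurable_fun_upd[where J=I])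
    have eq: "(\<lambda>x i. if i \<in> insert j J then x i + c i * x k else x i) = ?S \<circ> ?A"
      using j by (auto simp: fun_eq_iff)
    have "distr ?L ?L (?S \<circ> ?A) = distr (distr ?L ?L ?A) ?L ?S"
      by (rule distr_distr[symmetric, OF S IH(1)])
    also have "\<dots> = ?L"
      unfolding IH(2) by (rule distr_PiM_lborel_shear) (use assms j in auto)
    finally show ?case
      unfolding eq using measurable_comp[OF IH(1) S] by blast
  qed
qed

text \<open>Division by zero makes this the identity on \<open>I\<close> if \<open>v\<close> vanishes there.\<close>

definition refl_on_coords :: "'i set \<Rightarrow> ('i \<Rightarrow> real) \<Rightarrow> ('i \<Rightarrow> real) \<Rightarrow> 'i \<Rightarrow> real" where
  "refl_on_coords I v x = (\<lambda>i\<in>I. x i - 2 * (\<Sum>l\<in>I. v l * x l) / (\<Sum>l\<in>I. (v l)\<^sup>2) * v i)"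

lemma measurable_refl_on_coords [measurable]:
  "refl_on_coords I v \<in> measurable (PiM I (\<lambda>_. lborel)) (PiM I (\<lambda>_. lborel))"
  unfolding refl_on_coords_def by measurable

text \<open>Reflections are self-adjoint, because the bilinear form in \<open>*\<close> is symmetric
  in its two arguments. This moves a reflection of the noise onto the coefficient vectors.\<close>

lemma sum_refl_on_coords_mult:
  assumes "finite I"
  shows "(\<Sum>i\<in>I. refl_on_coords I v x i * y i) = (\<Sum>i\<in>I. x i * refl_on_coords I v y i)"
proof -
  define c where "c = 2 / (\<Sum>l\<in>I. (v l)\<^sup>2)"
  have *: "(\<Sum>i\<in>I. refl_on_coords I v x i * y i)
      = (\<Sum>i\<in>I. x i * y i) - c * (\<Sum>i\<in>I. v i * x i) * (\<Sum>i\<in>I. v i * y i)" for x y :: "'a \<Rightarrow> real"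
  proof -
    have "(\<Sum>i\<in>I. refl_on_coords I v x i * y i)
        = (\<Sum>i\<in>I. x i * y i - c * (\<Sum>i\<in>I. v i * x i) * (v i * y i))"
      by (rule sum.cong) (simp_all add: refl_on_coords_def c_def left_diff_distrib)
    then show ?thesis by (simp only: sum_subtractf flip: sum_distrib_left)
  qed
  show ?thesis
    using *[of x y] *[of y x] by (simp add: mult_ac)
qed

text \<open>The reflection factors into maps that shear or flip coordinates, each of which preserves
  Lebesgue measure. The index \<open>k\<close> is a pivot at which \<open>v\<close> can be divided
  by.\<close>

lemma distr_PiM_lborel_refl:
  fixes I :: "'i set"
  assumes "finite I" "k \<in> I" "v k \<noteq> 0"
  shows "distr (PiM I (\<lambda>_. lborel)) (PiM I (\<lambda>_. lborel)) (refl_on_coords I v) = PiM I (\<lambda>_. lborel)"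
proof -
  let ?L = "PiM I (\<lambda>_. lborel) :: ('i \<Rightarrow> real) measure"
  define N where "N = (\<Sum>l\<in>I. (v l)\<^sup>2)"
  define a where "a = 2 / N"
  have "N > 0" unfolding N_def using assms by (intro sum_pos2[of _ k]) auto
  \<comment> \<open>In the sheared coordinates \<open>x k\<close> gets the coefficient
    \<open>1 - a * N\<close>, which is therefore -1. This is what makes \<open>K\<close> measure
    preserving.\<close>
  then have aN: "a * N = 2" by (simp add: a_def)
  txt \<open>The shear \<open>A (-1)\<close> maps \<open>v\<close> to a multiple of the \<open>k\<close>-th unit vector, so conjugating the
    reflection by it leaves a map \<open>K\<close> that changes only coordinate \<open>k\<close>.\<close>
  define A where "A = (\<lambda>r (x::'i\<Rightarrow>real) i. if i \<in> I - {k} then x i + (r * v i / v k) * x k else x i)"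
  define g where "g = (\<lambda>x. - a * v k * (\<Sum>i\<in>I-{k}. v i * x i))"
  define K where "K = (\<lambda>x::'i\<Rightarrow>real. x(k := -1 * x k + g x))"
  have A: "A r \<in> measurable ?L ?L" "distr ?L ?L (A r) = ?L" for r
    unfolding A_def
    using distr_PiM_lborel_multi_shear[OF assms(1,2) subset_refl, of "\<lambda>i. r * v i / v k"] by auto
  have g: "g \<in> borel_measurable ?L" unfolding g_def by measurable
  have K: "K \<in> measurable ?L ?L"
    unfolding K_def using assms(2) g by (auto intro!: measurable_fun_upd[where J=I])
  have dK: "distr ?L ?L K = ?L"
    unfolding K_def
    by (rule distr_PiM_lborel_shear[OF assms(1,2) _ g]) (auto simp: g_def intro!: sum.cong)
  have eq: "refl_on_coords I v x = (A 1 \<circ> (K \<circ> A (-1))) x" if x: "x \<in> space ?L" for x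
  proof
    fix i
    define S where "S = (\<Sum>i\<in>I-{k}. v i * x i)"
    have S: "(\<Sum>l\<in>I. v l * x l) = v k * x k + S"
      unfolding S_def using assms by (simp add: sum.remove)
    have N: "N = (v k)\<^sup>2 + (\<Sum>l\<in>I-{k}. (v l)\<^sup>2)"
      unfolding N_def using assms by (simp add: sum.remove)
    have "(\<Sum>i\<in>I-{k}. v i * A (-1) x i) = (\<Sum>i\<in>I-{k}. v i * x i - (v i)\<^sup>2 * (x k / v k))"
      by (rule sum.cong) (auto simp: A_def power2_eq_square algebra_simps)
    also have "\<dots> = S - (N - (v k)\<^sup>2) * (x k / v k)"
      by (simp only: sum_subtractf S_def N add_diff_cancel_left' flip: sum_distrib_right)
    finally have "K (A (-1) x) k = - x k - a * v k * (S - (N - (v k)\<^sup>2) * (x k / v k))"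
      by (simp add: K_def g_def A_def)
    also have "\<dots> = - x k - a * v k * S + (a * N) * x k - a * (v k)\<^sup>2 * x k"
      using assms(3) by (simp add: field_simps power2_eq_square)
    finally have Kk: "K (A (-1) x) k = x k - a * v k * (v k * x k + S)"
      unfolding aN by (simp add: algebra_simps power2_eq_square)
    have Ki: "K (A (-1) x) i = x i - v i / v k * x k" if "i \<in> I" "i \<noteq> k" for i
      using that by (simp add: K_def A_def)
    \<comment> \<open>Off \<open>I\<close> the reflection returns \<open>undefined\<close>, whereas
      the shears change nothing. The two agree only because points of the product space are
      extensional.\<close>
    have ext: "x i = undefined" if "i \<notin> I"
      using x that by (auto simp: space_PiM PiE_def extensional_def)
    show "refl_on_coords I v x i = (A 1 \<circ> (K \<circ> A (-1))) x i"
    proof (cases "i \<in> I")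
      case True
      have A1: "A 1 u j = (if j = k then u j else u j + v j / v k * u k)" if "j \<in> I" for u j
        using that by (simp add: A_def)
      have "refl_on_coords I v x i = x i - a * (v k * x k + S) * v i"
        using True by (simp add: refl_on_coords_def a_def flip: S N_def)
      also have "\<dots> = A 1 (K (A (-1) x)) i"
        using True assms(3) by (cases "i = k") (simp_all add: A1 Kk Ki field_simps)
      finally show ?thesis by simp
    next
      case False
      then show ?thesis
        using ext assms(2) by (auto simp: refl_on_coords_def A_def K_def)
    qed
  qed
  have "distr ?L ?L (refl_on_coords I v) = distr ?L ?L (A 1 \<circ> (K \<circ> A (-1)))"
    by (rule distr_cong) (use eq in auto)
  also have "\<dots> = distr (distr (distr ?L ?L (A (-1))) ?L K) ?L (A 1)"
    by (simp only: distr_distr[OF K A(1)] distr_distr[OF A(1) measurable_comp[OF A(1) K]])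
  also have "\<dots> = ?L" by (simp add: A dK)
  finally show ?thesis .
qed

text \<open>A product measure is determined by its values on boxes, and there the integrand factors
  over the coordinates.\<close>

lemma PiM_density_lborel:
  fixes f :: "real \<Rightarrow> ennreal"
  assumes "finite I" and [measurable]: "f \<in> borel_measurable borel"
    and sf: "sigma_finite_measure (density lborel f)"
  shows "PiM I (\<lambda>_. density lborel f) = density (PiM I (\<lambda>_. lborel)) (\<lambda>x. \<Prod>i\<in>I. f (x i))"
proof -
  interpret D: product_sigma_finite "\<lambda>_. density lborel f"
    using sf by (simp add: product_sigma_finite_def)
  show ?thesis
  proof (rule D.PiM_eqI[OF assms(1), symmetric])
    show "sets (density (PiM I (\<lambda>_. lborel)) (\<lambda>x. \<Prod>i\<in>I. f (x i))) = sets (PiM I (\<lambda>_. density lborel f))"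
      by (simp cong: sets_PiM_cong)
    fix A assume "\<And>i. i \<in> I \<Longrightarrow> A i \<in> sets (density lborel f)"
    then have [measurable]: "\<And>i. i \<in> I \<Longrightarrow> A i \<in> sets borel" by simp
    have "Pi\<^sub>E I A \<in> sets (PiM I (\<lambda>_. lborel))"
      using assms(1) by (intro sets_PiM_I_finite) auto
    then have "emeasure (density (PiM I (\<lambda>_. lborel)) (\<lambda>x. \<Prod>i\<in>I. f (x i))) (Pi\<^sub>E I A)
        = (\<integral>\<^sup>+ x. (\<Prod>i\<in>I. f (x i)) * indicator (Pi\<^sub>E I A) x \<partial>PiM I (\<lambda>_. lborel))"
      by (simp add: emeasure_density)
    also have "\<dots> = (\<integral>\<^sup>+ x. (\<Prod>i\<in>I. f (x i) * indicator (A i) (x i)) \<partial>PiM I (\<lambda>_. lborel))"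
    proof (rule nn_integral_cong)
      fix x :: "'a \<Rightarrow> real" assume "x \<in> space (PiM I (\<lambda>_. lborel))"
      then have "indicator (Pi\<^sub>E I A) x = (\<Prod>i\<in>I. indicator (A i) (x i) :: ennreal)"
        using assms(1) by (auto simp: space_PiM PiE_def indicator_def Pi_iff intro!: prod.neutral[symmetric])
      then show "(\<Prod>i\<in>I. f (x i)) * indicator (Pi\<^sub>E I A) x = (\<Prod>i\<in>I. f (x i) * indicator (A i) (x i))"
        by (simp add: prod.distrib)
    qed
    also have "\<dots> = (\<Prod>i\<in>I. \<integral>\<^sup>+ x. f x * indicator (A i) x \<partial>lborel)"
      using assms(1) by (intro lborel_product.product_nn_integral_prod) auto
    also have "\<dots> = (\<Prod>i\<in>I. emeasure (density lborel f) (A i))"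
      by (intro prod.cong) (auto simp: emeasure_density)
    finally show "emeasure (density (PiM I (\<lambda>_. lborel)) (\<lambda>x. \<Prod>i\<in>I. f (x i))) (Pi\<^sub>E I A)
        = (\<Prod>i\<in>I. emeasure (density lborel f) (A i))" .
  qed
qed

text \<open>Reflections are isometries: the factor 2 makes the quadratic term cancel the cross
  term.\<close>

lemma sum_refl_on_coords_power2:
  "(\<Sum>i\<in>I. (refl_on_coords I v x i)\<^sup>2) = (\<Sum>i\<in>I. (x i)\<^sup>2)"
proof -
  define N where "N = (\<Sum>l\<in>I. (v l)\<^sup>2)"
  define S where "S = (\<Sum>l\<in>I. v l * x l)"
  define c where "c = 2 * S / N"
  have "(\<Sum>i\<in>I. (refl_on_coords I v x i)\<^sup>2) = (\<Sum>i\<in>I. (x i)\<^sup>2 - (2 * c) * (v i * x i) + c\<^sup>2 * (v i)\<^sup>2)"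
    by (rule sum.cong) (simp_all add: refl_on_coords_def c_def S_def N_def power2_eq_square algebra_simps)
  also have "\<dots> = (\<Sum>i\<in>I. (x i)\<^sup>2) - 2 * c * S + c\<^sup>2 * N"
    by (simp only: sum.distrib sum_subtractf S_def N_def flip: sum_distrib_left)
  \<comment> \<open>For \<open>N = 0\<close> both sides are 0, as \<open>c\<close> is then 0 as
    well.\<close>
  also have "c\<^sup>2 * N = 2 * c * S"
    by (simp add: c_def power2_eq_square)
  finally show ?thesis by simp
qed

text \<open>Two vectors of equal length are exchanged by the reflection along their difference,
  since twice the inner product of \<open>a - b\<close> with \<open>a\<close> is the squared length
  of \<open>a - b\<close>.\<close>

lemma refl_on_coords_diff:
  assumes "i \<in> I" "(\<Sum>l\<in>I. (a l)\<^sup>2) = (\<Sum>l\<in>I. (b l)\<^sup>2)" "(\<Sum>l\<in>I. (a l - b l)\<^sup>2) \<noteq> 0"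
  shows "refl_on_coords I (\<lambda>l. a l - b l) a i = b i"
    and "refl_on_coords I (\<lambda>l. a l - b l) b i = a i"
proof -
  let ?N = "\<Sum>l\<in>I. (a l - b l)\<^sup>2"
  have N: "?N = (\<Sum>l\<in>I. (a l)\<^sup>2) + (\<Sum>l\<in>I. (b l)\<^sup>2) - 2 * (\<Sum>l\<in>I. a l * b l)"
    by (simp add: power2_diff sum.distrib sum_subtractf sum_distrib_left mult.assoc)
  have "(\<Sum>l\<in>I. (a l - b l) * a l) = (\<Sum>l\<in>I. (a l)\<^sup>2) - (\<Sum>l\<in>I. a l * b l)"
    by (simp add: left_diff_distrib sum_subtractf power2_eq_square mult.commute[of "b _"])
  then have a: "2 * (\<Sum>l\<in>I. (a l - b l) * a l) = ?N" unfolding N using assms(2) by simp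
  have "(\<Sum>l\<in>I. (a l - b l) * b l) = (\<Sum>l\<in>I. a l * b l) - (\<Sum>l\<in>I. (b l)\<^sup>2)"
    by (simp add: left_diff_distrib sum_subtractf power2_eq_square)
  then have b: "2 * (\<Sum>l\<in>I. (a l - b l) * b l) = - ?N" unfolding N using assms(2) by simp
  show "refl_on_coords I (\<lambda>l. a l - b l) a i = b i" "refl_on_coords I (\<lambda>l. a l - b l) b i = a i"
    unfolding refl_on_coords_def a b using assms(1,3) by simp_all
qed

lemma refl_on_coords_orthogonal:
  assumes "i \<in> I" "(\<Sum>l\<in>I. v l * x l) = 0"
  shows "refl_on_coords I v x i = x i"
  using assms by (simp add: refl_on_coords_def)

text \<open>The joint density depends on \<open>x\<close> only through its length, hence is
  invariant under isometries.\<close>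

lemma prod_normal_density:
  assumes "finite I"
  shows "(\<Prod>i\<in>I. normal_density 0 \<sigma> (x i))
       = (1 / sqrt (2 * pi * \<sigma>\<^sup>2)) ^ card I * exp (- (\<Sum>i\<in>I. (x i)\<^sup>2) / (2 * \<sigma>\<^sup>2))"
proof -
  have "(\<Prod>i\<in>I. normal_density 0 \<sigma> (x i))
      = (\<Prod>i\<in>I. 1 / sqrt (2 * pi * \<sigma>\<^sup>2)) * (\<Prod>i\<in>I. exp (- (x i)\<^sup>2 / (2 * \<sigma>\<^sup>2)))"
    unfolding normal_density_def by (simp only: prod.distrib diff_zero)
  then show ?thesis
    using assms by (simp add: exp_sum[symmetric] sum_negf sum_divide_distrib)
qed

text \<open>Both ingredients of the Gaussian measure, Lebesgue measure and the density
  \<open>h\<close>, are invariant under the reflection.\<close>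

lemma distr_PiM_normal_refl:
  fixes I :: "'i set" and \<sigma> :: real
  assumes "finite I" "k \<in> I" "v k \<noteq> 0"
  defines "G \<equiv> PiM I (\<lambda>_. density lborel (normal_density 0 \<sigma>))"
  assumes "0 < \<sigma>"
  shows "distr G (PiM I (\<lambda>_. lborel)) (refl_on_coords I v) = G"
proof -
  let ?L = "PiM I (\<lambda>_. lborel) :: ('i \<Rightarrow> real) measure"
  let ?T = "refl_on_coords I v"
  define h where "h = (\<lambda>x. \<Prod>i\<in>I. ennreal (normal_density 0 \<sigma> (x i)))"
  have [measurable]: "h \<in> borel_measurable ?L" unfolding h_def by measurable
  have G: "G = density ?L h"
    unfolding G_def h_def using assms prob_space_normal_density[of \<sigma> 0]
    by (intro PiM_density_lborel) (auto intro: prob_space_imp_sigma_finite)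
  have h: "h (?T x) = h x" for x
    unfolding h_def using assms(1)
    by (simp add: prod_ennreal prod_normal_density sum_refl_on_coords_power2)
  have "distr G ?L ?T = distr (density ?L (\<lambda>x. h (?T x))) ?L ?T"
    by (simp add: G h)
  also have "\<dots> = density (distr ?L ?L ?T) h"
    by (rule density_distr[symmetric]) measurable
  also have "\<dots> = G"
    using distr_PiM_lborel_refl[of I k v] assms(1-3) by (simp add: G)
  finally show ?thesis .
qed

section \<open>Linear combinations of independent centred normal variables\<close>

locale iid_normal = prob_space M for M :: "'w measure" +
  fixes I :: "'i set" and \<sigma> :: real and eps :: "'i \<Rightarrow> 'w \<Rightarrow> real"
  assumes finite_I: "finite I" and sigma_pos: "0 < \<sigma>"
    and indep: "indep_vars (\<lambda>_. borel) eps I"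
    and normal: "\<And>i. i \<in> I \<Longrightarrow> distributed M lborel (eps i) (normal_density 0 \<sigma>)"
begin

definition lin :: "('i \<Rightarrow> real) \<Rightarrow> 'w \<Rightarrow> real" where
  "lin a \<omega> = (\<Sum>i\<in>I. a i * eps i \<omega>)"

lemma measurable_eps [measurable]: "i \<in> I \<Longrightarrow> eps i \<in> borel_measurable M"
  using indep by (auto simp: indep_vars_def)

lemma measurable_lin [measurable]: "lin a \<in> borel_measurable M"
  unfolding lin_def by measurable

lemma lin_scale: "lin (\<lambda>i. c * a i) \<omega> = c * lin a \<omega>"
  by (simp add: lin_def sum_distrib_left mult.assoc)

lemma lin_diff: "lin (\<lambda>i. a i - b i) \<omega> = lin a \<omega> - lin b \<omega>"
  by (simp add: lin_def left_diff_distrib sum_subtractf)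

lemma distributed_lin:
  assumes "(\<Sum>i\<in>I. (a i)\<^sup>2) \<noteq> 0"
  shows "distributed M lborel (lin a) (normal_density 0 (\<sigma> * sqrt (\<Sum>i\<in>I. (a i)\<^sup>2)))"
proof -
  \<comment> \<open>Indices with coefficient 0 are dropped: such a summand is degenerate and has no
    normal density.\<close>
  define J where "J = {i\<in>I. a i \<noteq> 0}"
  have J: "finite J" "J \<subseteq> I" "\<And>i. i \<in> J \<Longrightarrow> a i \<noteq> 0" using finite_I by (auto simp: J_def)
  have sq: "(\<Sum>i\<in>I. (a i)\<^sup>2) = (\<Sum>i\<in>J. (a i)\<^sup>2)"
    unfolding J_def using finite_I by (intro sum.mono_neutral_right) auto
  then have "J \<noteq> {}" using assms by auto
  have "distributed M lborel (\<lambda>\<omega>. \<Sum>i\<in>J. a i * eps i \<omega>)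
      (normal_density (\<Sum>i\<in>J. 0) (sqrt (\<Sum>i\<in>J. (\<bar>a i\<bar> * \<sigma>)\<^sup>2)))"
  proof (rule sum_indep_normal)
    show "indep_vars (\<lambda>i. borel) (\<lambda>i \<omega>. a i * eps i \<omega>) J"
      by (rule indep_vars_compose2[OF indep_vars_subset[OF indep J(2)]]) measurable
    show "distributed M lborel (\<lambda>\<omega>. a i * eps i \<omega>) (normal_density 0 (\<bar>a i\<bar> * \<sigma>))" if "i \<in> J" for i
      using normal_density_affine[OF normal sigma_pos, of i "a i" 0] that J by auto
  qed (use J \<open>J \<noteq> {}\<close> sigma_pos in auto)
  moreover have "(\<lambda>\<omega>. \<Sum>i\<in>J. a i * eps i \<omega>) = lin a"
    unfolding J_def lin_def using finite_I by (auto intro!: sum.mono_neutral_left)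
  moreover have "sqrt (\<Sum>i\<in>J. (\<bar>a i\<bar> * \<sigma>)\<^sup>2) = \<sigma> * sqrt (\<Sum>i\<in>I. (a i)\<^sup>2)"
    using sigma_pos by (simp add: power_mult_distrib real_sqrt_mult sq flip: sum_distrib_right)
  ultimately show ?thesis by simp
qed

text \<open>A nondegenerate combination has a density, so it has no atoms. This makes ties null
  events.\<close>

lemma AE_lin_neq:
  assumes "(\<Sum>i\<in>I. (a i)\<^sup>2) \<noteq> 0"
  shows "AE \<omega> in M. lin a \<omega> \<noteq> t"
proof -
  have "AE x in lborel. x \<noteq> t" by (rule AE_lborel_singleton)
  then show ?thesis
    by (subst distributed_AE2[OF distributed_lin[OF assms]]) auto
qed

lemma distr_eps:
  assumes "I \<noteq> {}"
  shows "distr M (PiM I (\<lambda>_. lborel)) (\<lambda>\<omega>. \<lambda>i\<in>I. eps i \<omega>)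
       = PiM I (\<lambda>_. density lborel (normal_density 0 \<sigma>))"
proof -
  have "distr M (PiM I (\<lambda>_. lborel)) (\<lambda>\<omega>. \<lambda>i\<in>I. eps i \<omega>) = distr M (PiM I (\<lambda>_. borel)) (\<lambda>\<omega>. \<lambda>i\<in>I. eps i \<omega>)"
    by (intro distr_cong) (auto cong: sets_PiM_cong)
  also have "\<dots> = PiM I (\<lambda>i. distr M borel (eps i))"
    using indep_vars_iff_distr_eq_PiM'[of I eps "\<lambda>_. borel"] indep assms by auto
  also have "\<dots> = PiM I (\<lambda>_. density lborel (normal_density 0 \<sigma>))"
  proof (rule PiM_cong)
    fix i assume "i \<in> I"
    have "distr M borel (eps i) = distr M lborel (eps i)" by (rule distr_cong) auto
    then show "distr M borel (eps i) = density lborel (normal_density 0 \<sigma>)"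
      using normal[OF \<open>i \<in> I\<close>] by (simp add: distributed_def)
  qed simp
  finally show ?thesis .
qed

lemma prob_refl:
  assumes "k \<in> I" "v k \<noteq> 0" and [measurable]: "Measurable.pred (PiM I (\<lambda>_. lborel)) P"
  shows "prob {\<omega> \<in> space M. P (refl_on_coords I v (\<lambda>i\<in>I. eps i \<omega>))}
       = prob {\<omega> \<in> space M. P (\<lambda>i\<in>I. eps i \<omega>)}"
proof -
  let ?L = "PiM I (\<lambda>_. lborel) :: ('i \<Rightarrow> real) measure"
  let ?E = "\<lambda>\<omega>. \<lambda>i\<in>I. eps i \<omega>"
  let ?T = "refl_on_coords I v"
  have E [measurable]: "?E \<in> measurable M ?L" by measurable
  have S: "{x \<in> space ?L. P x} \<in> sets ?L" by measurable
  have "distr M ?L (?T \<circ> ?E) = distr (distr M ?L ?E) ?L ?T"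
    by (rule distr_distr[symmetric]) measurable
  also have "\<dots> = distr M ?L ?E"
  proof -
    have "I \<noteq> {}" using assms(1) by auto
    then show ?thesis
      using assms(1,2) finite_I sigma_pos by (simp add: distr_eps distr_PiM_normal_refl)
  qed
  finally have "measure (distr M ?L (?T \<circ> ?E)) {x \<in> space ?L. P x} = measure (distr M ?L ?E) {x \<in> space ?L. P x}"
    by simp
  moreover have "measure (distr M ?L (?T \<circ> ?E)) {x \<in> space ?L. P x} = prob {\<omega> \<in> space M. P (?T (?E \<omega>))}"
    using S measurable_space[OF E] measurable_space[OF measurable_refl_on_coords[of I v]]
    by (subst measure_distr) (auto intro!: arg_cong[where f=prob])
  moreover have "measure (distr M ?L ?E) {x \<in> space ?L. P x} = prob {\<omega> \<in> space M. P (?E \<omega>)}"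
    using S measurable_space[OF E] by (subst measure_distr) (auto intro!: arg_cong[where f=prob])
  ultimately show ?thesis by simp
qed

text \<open>There are \<open>2 * card J\<close> signed vectors \<open>s * u k\<close>. Almost surely
  exactly one of them has the largest inner product with the noise, and reflections show that each
  is equally likely to be that one.\<close>

lemma prob_lin_max:
  fixes u :: "'j \<Rightarrow> 'i \<Rightarrow> real"
  assumes "finite J" "j0 \<in> J"
    and orth: "\<And>j k. j \<in> J \<Longrightarrow> k \<in> J \<Longrightarrow> (\<Sum>i\<in>I. u j i * u k i) = (if j = k then 1 else 0)"
  shows "prob {\<omega> \<in> space M. \<forall>j\<in>J. \<bar>lin (u j) \<omega>\<bar> \<le> lin (u j0) \<omega>} = 1 / (2 * real (card J))"
proof -
  define A where "A = (\<lambda>(s, k). {\<omega> \<in> space M. \<forall>j\<in>J. \<bar>lin (u j) \<omega>\<bar> \<le> s * lin (u k) \<omega>})"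
  define Q :: "(real \<times> 'j) set" where "Q = {1, -1} \<times> J"
  have [measurable]: "A q \<in> events" for q
    unfolding A_def using assms(1) by (cases q) (simp add: countable_finite)
  have norm: "(\<Sum>i\<in>I. (u j i)\<^sup>2) = 1" if "j \<in> J" for j
    using orth[OF that that] by (simp add: power2_eq_square)
  \<comment> \<open>The squared distance of two distinct signed vectors is 2 if \<open>j\<close> and
    \<open>k\<close> differ, and 4 if they are opposite. This gives both a nonzero reflection vector
    and the nullity of ties.\<close>
  have sep: "(\<Sum>i\<in>I. (s * u j i - t * u k i)\<^sup>2) \<noteq> 0"
    if "(s, j) \<in> Q" "(t, k) \<in> Q" "(s, j) \<noteq> (t, k)" for s t j k
  proof -
    have "(\<Sum>i\<in>I. (s * u j i - t * u k i)\<^sup>2)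
        = s\<^sup>2 * (\<Sum>i\<in>I. (u j i)\<^sup>2) + t\<^sup>2 * (\<Sum>i\<in>I. (u k i)\<^sup>2) - 2 * s * t * (\<Sum>i\<in>I. u j i * u k i)"
      by (simp add: power2_diff power_mult_distrib sum.distrib sum_subtractf sum_distrib_left mult_ac)
    also have "\<dots> \<noteq> 0"
      using that norm[of j] norm[of k] orth[of j k] by (auto simp: Q_def)
    finally show ?thesis .
  qed
  have equal: "prob (A (s, k)) = prob (A (1, j0))" if q: "(s, k) \<in> Q" for s k
  proof (cases "(s, k) = (1, j0)")
    case False
    define b where "b = (\<lambda>i. s * u k i)"
    \<comment> \<open>The reflection along \<open>v\<close> swaps \<open>u j0\<close> with
      \<open>s * u k\<close>. The case \<open>k = j0\<close>, \<open>s = -1\<close> is included: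
      there it negates \<open>u j0\<close>.\<close>
    define v where "v = (\<lambda>i. u j0 i - b i)"
    let ?T = "refl_on_coords I v"
    have k: "k \<in> J" and s: "s * s = 1" using q by (auto simp: Q_def)
    have v2: "(\<Sum>i\<in>I. (v i)\<^sup>2) \<noteq> 0"
      using sep[OF _ q, of 1 j0] False assms(2) by (auto simp: v_def b_def Q_def)
    then obtain i0 where i0: "i0 \<in> I" "v i0 \<noteq> 0"
      by (metis (no_types, lifting) sum.neutral zero_power2)
    have b2: "(\<Sum>i\<in>I. (u j0 i)\<^sup>2) = (\<Sum>i\<in>I. (b i)\<^sup>2)"
      using norm[OF assms(2)] norm[OF k] s
      by (simp add: b_def power_mult_distrib power2_eq_square[of s] flip: sum_distrib_left)
    define W where "W = (\<lambda>j x. \<Sum>i\<in>I. u j i * x i)"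
    have lin: "lin (u j) \<omega> = W j (\<lambda>i\<in>I. eps i \<omega>)" for j \<omega>
      by (simp add: lin_def W_def)
    have adj: "W j (?T x) = (\<Sum>i\<in>I. ?T (u j) i * x i)" for j x
      unfolding W_def by (rule sum_refl_on_coords_mult[symmetric, OF finite_I])
    have Wj0: "W j0 (?T x) = s * W k x" for x
    proof -
      have "W j0 (?T x) = (\<Sum>i\<in>I. b i * x i)"
        unfolding adj using v2 b2 by (intro sum.cong) (simp_all add: v_def refl_on_coords_diff)
      then show ?thesis by (simp add: W_def b_def sum_distrib_left mult.assoc)
    qed
    have Wk: "W k (?T x) = s * W j0 x" for x
    proof -
      have "s * W k (?T x) = (\<Sum>i\<in>I. b i * ?T x i)"
        by (simp add: W_def b_def sum_distrib_left mult.assoc)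
      also have "\<dots> = (\<Sum>i\<in>I. ?T b i * x i)"
        by (rule sum_refl_on_coords_mult[symmetric, OF finite_I])
      also have "\<dots> = W j0 x"
        unfolding W_def using v2 b2 by (intro sum.cong) (simp_all add: v_def refl_on_coords_diff)
      finally have "s * s * W k (?T x) = s * W j0 x" by (simp add: mult.assoc)
      then show ?thesis by (simp add: s)
    qed
    have Wj: "W j (?T x) = W j x" if j: "j \<in> J" "j \<noteq> j0" "j \<noteq> k" for j x
    proof -
      have "(\<Sum>i\<in>I. v i * u j i) = (\<Sum>i\<in>I. u j0 i * u j i) - s * (\<Sum>i\<in>I. u k i * u j i)"
        by (simp add: v_def b_def left_diff_distrib sum_subtractf sum_distrib_left mult.assoc)
      also have "\<dots> = 0" using orth j k assms(2) by simp
      finally show ?thesis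
        unfolding adj unfolding W_def by (intro sum.cong) (simp_all add: refl_on_coords_orthogonal)
    qed
    have s1: "\<bar>s\<bar> = 1" using q by (auto simp: Q_def)
    have eq: "(\<forall>j\<in>J. \<bar>W j (?T x)\<bar> \<le> W j0 (?T x)) \<longleftrightarrow> (\<forall>j\<in>J. \<bar>W j x\<bar> \<le> s * W k x)" for x
    proof -
      \<comment> \<open>Up to sign the reflection permutes the \<open>W j\<close> by a transposition
        (the identity if \<open>k = j0\<close>), and absolute values absorb the sign.\<close>
      have "\<bar>W j (?T x)\<bar> = \<bar>W (Transposition.transpose j0 k j) x\<bar>" if "j \<in> J" for j
        using that Wj0 Wk Wj[of j x] s1
        by (cases "j = j0"; cases "j = k") (auto simp: abs_mult)
      then have "(\<forall>j\<in>J. \<bar>W j (?T x)\<bar> \<le> W j0 (?T x)) \<longleftrightarrow> (\<forall>j\<in>J. \<bar>W (Transposition.transpose j0 k j) x\<bar> \<le> s * W k x)"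
        by (simp add: Wj0)
      also have "\<dots> \<longleftrightarrow> (\<forall>j\<in>Transposition.transpose j0 k ` J. \<bar>W j x\<bar> \<le> s * W k x)" by blast
      also have "Transposition.transpose j0 k ` J = J" using k assms(2) by (simp add: transpose_image_eq)
      finally show ?thesis .
    qed
    have W: "W j \<in> borel_measurable (PiM I (\<lambda>_. lborel))" for j
      unfolding W_def by measurable
    have "Measurable.pred (PiM I (\<lambda>_. lborel)) (\<lambda>x. \<bar>W j x\<bar> \<le> W j0 x)" for j
      unfolding pred_def by (intro borel_measurable_le borel_measurable_abs W)
    then have pred: "Measurable.pred (PiM I (\<lambda>_. lborel)) (\<lambda>x. \<forall>j\<in>J. \<bar>W j x\<bar> \<le> W j0 x)"
      using assms(1) by (intro pred_intros_finite)
    show ?thesis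
      using prob_refl[of i0 v, OF i0 pred] unfolding eq
      by (simp add: A_def lin)
  qed simp
  have disj: "AE \<omega> in M. \<omega> \<notin> A q \<or> \<omega> \<notin> A r" if "q \<in> Q" "r \<in> Q" "q \<noteq> r" for q r
  proof -
    obtain s j t k where qr: "q = (s, j)" "r = (t, k)" by (metis surj_pair)
    have "AE \<omega> in M. lin (\<lambda>i. s * u j i - t * u k i) \<omega> \<noteq> 0"
      using that sep by (intro AE_lin_neq) (auto simp: qr)
    then show ?thesis
    proof eventually_elim
      case (elim \<omega>)
      \<comment> \<open>On the overlap each of the two signed values bounds the other, so their
        difference vanishes, which \<open>elim\<close> excludes.\<close>
      have "s * lin (u j) \<omega> = t * lin (u k) \<omega>" if "\<omega> \<in> A q" "\<omega> \<in> A r"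
      proof (rule antisym)
        have "s * lin (u j) \<omega> \<le> \<bar>lin (u j) \<omega>\<bar>" "t * lin (u k) \<omega> \<le> \<bar>lin (u k) \<omega>\<bar>"
          using \<open>q \<in> Q\<close> \<open>r \<in> Q\<close> by (auto simp: qr Q_def)
        moreover have "\<bar>lin (u j) \<omega>\<bar> \<le> t * lin (u k) \<omega>" "\<bar>lin (u k) \<omega>\<bar> \<le> s * lin (u j) \<omega>"
          using that \<open>q \<in> Q\<close> \<open>r \<in> Q\<close> by (auto simp: qr A_def Q_def)
        ultimately show "s * lin (u j) \<omega> \<le> t * lin (u k) \<omega>" "t * lin (u k) \<omega> \<le> s * lin (u j) \<omega>"
          by linarith+
      qed
      with elim show ?case by (auto simp: lin_diff lin_scale)
    qed
  qed
  have "space M \<subseteq> (\<Union>q\<in>Q. A q)"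
  proof
    fix \<omega> assume \<omega>: "\<omega> \<in> space M"
    define m where "m = Max ((\<lambda>j. \<bar>lin (u j) \<omega>\<bar>) ` J)"
    have "m \<in> (\<lambda>j. \<bar>lin (u j) \<omega>\<bar>) ` J"
      unfolding m_def using assms by (intro Max_in) auto
    then obtain k where k: "k \<in> J" "m = \<bar>lin (u k) \<omega>\<bar>" by blast
    define s :: real where "s = (if lin (u k) \<omega> < 0 then -1 else 1)"
    have "\<bar>lin (u j) \<omega>\<bar> \<le> s * lin (u k) \<omega>" if "j \<in> J" for j
    proof -
      have "\<bar>lin (u j) \<omega>\<bar> \<le> m" unfolding m_def using assms(1) that by (intro Max_ge) auto
      also have "m = s * lin (u k) \<omega>" unfolding k(2) by (simp add: s_def)
      finally show ?thesis .
    qed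
    then have "\<omega> \<in> A (s, k)" "(s, k) \<in> Q" using \<omega> k by (auto simp: A_def Q_def s_def)
    then show "\<omega> \<in> (\<Union>q\<in>Q. A q)" by blast
  qed
  then have "(\<Union>q\<in>Q. A q) = space M" by (auto simp: A_def)
  then have "1 = prob (\<Union>q\<in>Q. A q)" by (simp add: prob_space)
  also have "\<dots> = (\<Sum>q\<in>Q. prob (A q))"
    using assms(1) disj by (intro measure_UNION_AE) (auto simp: Q_def fmeasurable_eq_sets pairwise_def)
  also have "\<dots> = (\<Sum>q\<in>Q. prob (A (1, j0)))"
    using equal by (intro sum.cong) auto
  also have "\<dots> = 2 * real (card J) * prob (A (1, j0))"
    by (simp add: Q_def card_cartesian_product)
  finally have "1 = 2 * real (card J) * prob (A (1, j0))" .
  moreover have "card J \<noteq> 0" using assms(1,2) by auto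
  ultimately show ?thesis by (simp add: A_def field_simps)
qed

end

text \<open>By symmetry \<open>Y = - X / \<sigma>\<close> is standard normal, and the event becomes
  \<open>Y < t / \<sigma>\<close>, which differs from the event of the distribution function by a
  null set.\<close>

lemma (in prob_space) prob_normal_gt_eq_cdf:
  assumes X: "distributed M lborel X (normal_density 0 \<sigma>)" and "0 < \<sigma>"
  shows "prob {\<omega> \<in> space M. - t < X \<omega>} = std_normal_cdf (t / \<sigma>)"
proof -
  have [measurable]: "X \<in> borel_measurable M" using X by (auto simp: distributed_def)
  have "AE x in lborel. x \<noteq> - t" by (rule AE_lborel_singleton)
  then have neq: "AE \<omega> in M. X \<omega> \<noteq> - t" by (subst distributed_AE2[OF X]) auto
  define Y where "Y = (\<lambda>\<omega>. 0 + (- 1 / \<sigma>) * X \<omega>)"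
  have "distributed M lborel Y (normal_density (0 + (- 1 / \<sigma>) * 0) (\<bar>- 1 / \<sigma>\<bar> * \<sigma>))"
    unfolding Y_def using assms by (intro normal_density_affine) auto
  then have Y: "distributed M lborel Y std_normal_density" using assms(2) by simp
  have [measurable]: "Y \<in> borel_measurable M" unfolding Y_def by measurable
  have "prob {\<omega> \<in> space M. - t < X \<omega>} = prob {\<omega> \<in> space M. Y \<omega> \<le> t / \<sigma>}"
  proof (rule measure_eq_AE)
    show "AE \<omega> in M. \<omega> \<in> {\<omega> \<in> space M. - t < X \<omega>} \<longleftrightarrow> \<omega> \<in> {\<omega> \<in> space M. Y \<omega> \<le> t / \<sigma>}"
      using neq
    proof eventually_elim
      case (elim \<omega>)
      then show ?case using assms(2) by (auto simp: Y_def field_simps)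
    qed
  qed measurable
  also have "\<dots> = measure (distr M lborel Y) {..t / \<sigma>}"
    by (subst measure_distr) (auto intro!: arg_cong[where f=prob])
  also have "\<dots> = std_normal_cdf (t / \<sigma>)"
    using Y by (simp add: std_normal_cdf_def cdf_def2 distributed_def)
  finally show ?thesis .
qed

section \<open>Comparison of the minimal losses\<close>

lemma loss_1_nonneg: "0 \<le> loss_1 n b z lam"
  by (simp add: loss_1_def)

lemma loss_1_le_loss_p: "loss_1 n b z lam \<le> loss_p n p b z lam"
  by (simp add: loss_1_def loss_p_def sum_nonneg)

lemma bdd_below_loss: "bdd_below (loss_1 n b z ` A)" "bdd_below (loss_p n p b z ` A)"
  using order_trans[OF loss_1_nonneg loss_1_le_loss_p] loss_1_nonneg by (auto intro!: bdd_belowI[of _ 0])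

lemma INF_loss_1_eq:
  fixes lam :: real
  assumes "0 \<le> lam" and "\<And>l. 0 \<le> l \<Longrightarrow> loss_1 n b z lam \<le> loss_1 n b z l"
  shows "(INF l\<in>{0..}. loss_1 n b z l) = loss_1 n b z lam"
  using assms by (intro antisym cINF_lower2 cINF_greatest bdd_below_loss) auto

text \<open>At a minimizer \<open>lam\<close> of the one-variable loss that dominates the other
  coordinates, the extra sum vanishes.\<close>

lemma INF_loss_p_le_INF_loss_1:
  assumes "0 \<le> lam" and "\<And>l. 0 \<le> l \<Longrightarrow> loss_1 n b z lam \<le> loss_1 n b z l"
    and "\<And>j. j \<in> {1..<p} \<Longrightarrow> \<bar>z j\<bar> \<le> lam"
  shows "(INF l\<in>{0..}. loss_p n p b z l) \<le> (INF l\<in>{0..}. loss_1 n b z l)"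
proof -
  have "loss_p n p b z lam = loss_1 n b z lam"
    using assms(3) by (auto simp: loss_p_def loss_1_def pos_part_def intro!: sum.neutral)
  moreover have "(INF l\<in>{0..}. loss_1 n b z l) = loss_1 n b z lam"
    using assms(1,2) by (rule INF_loss_1_eq)
  ultimately show ?thesis using assms(1)
    by (intro cINF_lower2[where x=lam] bdd_below_loss) auto
qed

text \<open>Pointwise strictness would not survive the infimum, so a uniform margin
  \<open>e\<^sup>2 / n\<close> is needed. Thresholds up to \<open>|z j| - e\<close> pay it through
  coordinate \<open>j\<close>, larger ones through \<open>gap\<close>.\<close>

lemma INF_loss_1_less_INF_loss_p:
  assumes "0 < n" "0 \<le> lam" "j \<in> {1..<p}" "0 < e"
    and minimal: "\<And>l. 0 \<le> l \<Longrightarrow> loss_1 n b z lam \<le> loss_1 n b z l"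
    and gap: "\<And>l. 0 \<le> l \<Longrightarrow> \<bar>z j\<bar> - e < l \<Longrightarrow> loss_1 n b z lam + e\<^sup>2 / n \<le> loss_1 n b z l"
  shows "(INF l\<in>{0..}. loss_1 n b z l) < (INF l\<in>{0..}. loss_p n p b z l)"
proof -
  have "loss_1 n b z lam + e\<^sup>2 / n \<le> loss_p n p b z l" if l: "0 \<le> l" for l
  proof (cases "\<bar>z j\<bar> - e < l")
    case True
    then show ?thesis using gap[OF l] loss_1_le_loss_p[of n b z l p] by linarith
  next
    case False
    then have "e\<^sup>2 \<le> (pos_part (\<bar>z j\<bar> - l))\<^sup>2"
      using \<open>0 < e\<close> by (intro power_mono) (auto simp: pos_part_def)
    also have "\<dots> \<le> (\<Sum>j\<in>{1..<p}. (pos_part (\<bar>z j\<bar> - l))\<^sup>2)"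
      using assms(3) by (intro member_le_sum) auto
    finally have "e\<^sup>2 / n \<le> (\<Sum>j\<in>{1..<p}. (pos_part (\<bar>z j\<bar> - l))\<^sup>2) / n"
      by (intro divide_right_mono) auto
    then show ?thesis using minimal[OF l] by (simp add: loss_1_def loss_p_def)
  qed
  then have "loss_1 n b z lam + e\<^sup>2 / n \<le> (INF l\<in>{0..}. loss_p n p b z l)"
    by (intro cINF_greatest) auto
  moreover have "0 < e\<^sup>2 / n" using assms by simp
  moreover have "(INF l\<in>{0..}. loss_1 n b z l) = loss_1 n b z lam"
    using assms(2) minimal by (rule INF_loss_1_eq)
  ultimately show ?thesis by linarith
qed

text \<open>Soft-thresholding is odd, so the sign of \<open>b\<close> can be moved into the data;
  this reduces to a positive coefficient.\<close>

lemma loss_1_sgn: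
  assumes "b \<noteq> 0"
  shows "loss_1 n b z lam = (\<bar>b\<bar> - soft_thr (sgn b * z 0) lam)\<^sup>2 / n"
  using assms by (cases "b > 0") (auto simp: loss_1_def soft_thr_def sgn_mult abs_mult sgn_minus power2_eq_square algebra_simps)

text \<open>For \<open>- |b| < D\<close> the fit is \<open>|b| + D - l\<close> until it reaches 0.
  It is exact at \<open>l = D\<close> if \<open>D\<close> is nonnegative; if \<open>D\<close> is
  negative, it is already too small at \<open>l = 0\<close> and any shrinkage makes it
  worse.\<close>

lemma INF_loss_less_iff:
  fixes z :: "nat \<Rightarrow> real"
  assumes "0 < n" "1 < p" "b \<noteq> 0"
  defines "D \<equiv> sgn b * z 0 - \<bar>b\<bar>"
  shows "(INF l\<in>{0..}. loss_1 n b z l) < (INF l\<in>{0..}. loss_p n p b z l) \<longleftrightarrow>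
    - \<bar>b\<bar> < D \<and> (\<exists>j\<in>{1..<p}. max D 0 < \<bar>z j\<bar>)"
proof (cases "D \<le> - \<bar>b\<bar>")
  case True
  \<comment> \<open>A threshold above every \<open>|z j|\<close>, so that all fits are 0. Here
    \<open>sgn b * z 0\<close> is nonpositive, hence so is every fit, and 0 is the one closest to
    \<open>|b|\<close>.\<close>
  define R where "R = \<bar>z 0\<bar> + (\<Sum>j\<in>{1..<p}. \<bar>z j\<bar>)"
  have R: "\<bar>z j\<bar> \<le> R" if "j \<in> {1..<p}" for j
    unfolding R_def using member_le_sum[OF that, of "\<lambda>j. \<bar>z j\<bar>"] by fastforce
  have R0: "\<bar>z 0\<bar> \<le> R" unfolding R_def by (simp add: sum_nonneg)
  have "0 \<le> R" using R0 by linarith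
  have "loss_1 n b z R \<le> loss_1 n b z l" for l
  proof -
    have "soft_thr (sgn b * z 0) R = 0" using R0 assms(3)
      by (simp add: soft_thr_def pos_part_def abs_mult abs_sgn_eq)
    moreover have "soft_thr (sgn b * z 0) l \<le> 0"
      using True unfolding D_def
      by (auto simp: soft_thr_def pos_part_def mult_le_0_iff sgn_if)
    ultimately show ?thesis
      unfolding loss_1_sgn[OF assms(3)] by (intro divide_right_mono power_mono) auto
  qed
  then have "(INF l\<in>{0..}. loss_p n p b z l) \<le> (INF l\<in>{0..}. loss_1 n b z l)"
    using \<open>0 \<le> R\<close> R by (intro INF_loss_p_le_INF_loss_1)
  then show ?thesis using True by simp
next
  case False
  then have pos: "0 < sgn b * z 0" by (simp add: D_def)
  define lam where "lam = max D 0"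
  have lam: "0 \<le> lam" by (simp add: lam_def)
  have loss: "loss_1 n b z l = (\<bar>b\<bar> - max (\<bar>b\<bar> + D - l) 0)\<^sup>2 / n" for l
    unfolding loss_1_sgn[OF assms(3)] soft_thr_def pos_part_def using pos by (simp add: D_def)
  \<comment> \<open>The smallest attainable residual, namely \<open>|b|\<close> minus the fit at
    \<open>lam\<close>.\<close>
  define m where "m = max (- D) 0"
  have at: "loss_1 n b z lam = m\<^sup>2 / n"
    unfolding loss using False by (auto simp: lam_def m_def max_def)
  have min: "loss_1 n b z lam \<le> loss_1 n b z l" if "0 \<le> l" for l
  proof -
    have "m\<^sup>2 \<le> (\<bar>b\<bar> - max (\<bar>b\<bar> + D - l) 0)\<^sup>2"
    proof (cases "D < 0")
      case True
      then show ?thesis using that False by (intro power_mono) (auto simp: m_def max_def)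
    qed (simp add: m_def)
    then show ?thesis unfolding at unfolding loss by (intro divide_right_mono) auto
  qed
  show ?thesis
  proof (cases "\<exists>j\<in>{1..<p}. lam < \<bar>z j\<bar>")
    case True
    then obtain j where j: "j \<in> {1..<p}" "lam < \<bar>z j\<bar>" by blast
    \<comment> \<open>Half of the excess gives \<open>lam + e \<le> |z j| - e\<close>. The second
      bound is the fit at \<open>lam\<close>, so the residual can still grow by \<open>e\<close>
      before the fit reaches 0.\<close>
    define e where "e = min ((\<bar>z j\<bar> - lam) / 2) (\<bar>b\<bar> + D - lam)"
    have e: "0 < e" using j False assms(3) by (auto simp: e_def lam_def)
    have gap: "loss_1 n b z lam + e\<^sup>2 / n \<le> loss_1 n b z l" if l: "0 \<le> l" "\<bar>z j\<bar> - e < l" for l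
    proof -
      have "e \<le> (\<bar>z j\<bar> - lam) / 2" "e \<le> \<bar>b\<bar> + D - lam" unfolding e_def by linarith+
      then have "lam + e \<le> l" "lam + e \<le> \<bar>b\<bar> + D" using l(2) by (auto simp: field_simps)
      then have "m + e \<le> \<bar>b\<bar> - max (\<bar>b\<bar> + D - l) 0"
        by (auto simp: m_def lam_def max_def split: if_splits)
      then have "(m + e)\<^sup>2 \<le> (\<bar>b\<bar> - max (\<bar>b\<bar> + D - l) 0)\<^sup>2"
        using e by (intro power_mono) (auto simp: m_def)
      moreover have "m\<^sup>2 + e\<^sup>2 \<le> (m + e)\<^sup>2"
        using e by (simp add: power2_sum m_def)
      ultimately show ?thesis
        unfolding at unfolding loss add_divide_distrib[symmetric] by (intro divide_right_mono) auto
    qed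
    have "(INF l\<in>{0..}. loss_1 n b z l) < (INF l\<in>{0..}. loss_p n p b z l)"
      using assms(1) lam j(1) e min gap by (rule INF_loss_1_less_INF_loss_p)
    then show ?thesis using True False
      by (simp add: lam_def)
  next
    case nex: False
    then have "\<bar>z j\<bar> \<le> lam" if "j \<in> {1..<p}" for j using that by force
    with lam min have "(INF l\<in>{0..}. loss_p n p b z l) \<le> (INF l\<in>{0..}. loss_1 n b z l)"
      by (rule INF_loss_p_le_INF_loss_1)
    then show ?thesis using nex
      by (simp add: lam_def)
  qed
qed

text \<open>Both losses are continuous in \<open>lam\<close> and constant once \<open>lam\<close>
  exceeds all \<open>|z j|\<close>, so the infima are minima. They are compared directly, not as a
  ratio, because the one-variable minimum is 0 whenever \<open>D\<close> is nonnegative.\<close>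

theorem theorem2p1:
  fixes M :: "'w measure"
    and n p :: nat
    and X :: "nat \<Rightarrow> nat \<Rightarrow> real"
    and b1 \<sigma> :: real
    and eps :: "nat \<Rightarrow> 'w \<Rightarrow> real"
  assumes "prob_space M"
    and "1 < p" and "p \<le> n"
    and orth: "\<forall>j<p. \<forall>k<p. (\<Sum>i<n. X i j * X i k) = (if j = k then 1 else 0)"
    and "b1 \<noteq> 0" and "\<sigma> > 0"
    and indep: "prob_space.indep_vars M (\<lambda>_. borel) eps {..<n}"
    and gauss: "\<forall>i<n. distributed M lborel (eps i) (normal_density 0 \<sigma>)"
  shows
    "let beta0 = (\<lambda>j::nat. if j = 0 then b1 else 0);
         y = (\<lambda>\<omega> i. (\<Sum>j<p. X i j * beta0 j) + eps i \<omega>);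
         z = (\<lambda>\<omega> j. \<Sum>i<n. X i j * y \<omega> i)
     in measure M {\<omega> \<in> space M.
           (INF lam\<in>{0..}. loss_p n p b1 (z \<omega>) lam) > (INF lam\<in>{0..}. loss_1 n b1 (z \<omega>) lam)}
        = std_normal_cdf (\<bar>b1\<bar> / \<sigma>) - 1 / (2 * real p)"
proof -
  interpret iid_normal M "{..<n}" \<sigma> eps
    using assms by (auto simp: iid_normal_def iid_normal_axioms_def)
  define b where "b = \<bar>b1\<bar>"
  define s where "s = sgn b1"
  have s: "s * b1 = b" "s * s = 1" "\<bar>s\<bar> = 1"
    using \<open>b1 \<noteq> 0\<close> by (auto simp: s_def b_def sgn_if)
  have n: "0 < n" using assms by simp
  \<comment> \<open>Column 0 carries the sign of \<open>b1\<close>, so that \<open>lin (u 0)\<close>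
    is \<open>D\<close>. The columns stay orthonormal because \<open>s * s = 1\<close>.\<close>
  define u where "u = (\<lambda>j i. (if j = 0 then s else 1) * X i j)"
  have uu: "(\<Sum>i<n. u j i * u k i) = (if j = k then 1 else 0)" if "j < p" "k < p" for j k
  proof -
    have "(\<Sum>i<n. u j i * u k i) = (if j = 0 then s else 1) * (if k = 0 then s else 1) * (\<Sum>i<n. X i j * X i k)"
      by (simp add: u_def sum_distrib_left mult_ac)
    then show ?thesis using orth that s by auto
  qed
  define D where "D = lin (u 0)"
  define W where "W = (\<lambda>j. lin (u j))"
  have [measurable]: "D \<in> borel_measurable M" "\<And>j. W j \<in> borel_measurable M"
    by (auto simp: D_def W_def)
  define z where "z = (\<lambda>\<omega> j. \<Sum>i<n. X i j * ((\<Sum>l<p. X i l * (if l = 0 then b1 else 0)) + eps i \<omega>))"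
  have z: "z \<omega> j = (if j = 0 then b1 else 0) + (\<Sum>i<n. X i j * eps i \<omega>)" if "j < p" for \<omega> j
  proof -
    have "(\<Sum>l<p. X i l * (if l = 0 then b1 else 0)) = X i 0 * b1" for i
      using \<open>1 < p\<close> by (simp add: if_distrib[where f="\<lambda>x. _ * x"] sum.delta cong: if_cong)
    then have "z \<omega> j = b1 * (\<Sum>i<n. X i j * X i 0) + (\<Sum>i<n. X i j * eps i \<omega>)"
      by (simp add: z_def distrib_left sum.distrib sum_distrib_left mult_ac)
    then show ?thesis using orth that \<open>1 < p\<close> by auto
  qed
  have zD: "sgn b1 * z \<omega> 0 - \<bar>b1\<bar> = D \<omega>" for \<omega>
  proof -
    have "sgn b1 * z \<omega> 0 = s * b1 + D \<omega>"
      using \<open>1 < p\<close> by (simp add: z D_def lin_def u_def s_def distrib_left sum_distrib_left mult.assoc)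
    then show ?thesis using s by (simp add: b_def)
  qed
  have zW: "z \<omega> j = W j \<omega>" if "j \<in> {1..<p}" for \<omega> j
    using that by (simp add: z W_def lin_def u_def)
  define E where "E = {\<omega> \<in> space M. - b < D \<omega> \<and> (\<exists>j\<in>{1..<p}. max (D \<omega>) 0 < \<bar>W j \<omega>\<bar>)}"
  define B where "B = {\<omega> \<in> space M. \<forall>j\<in>{..<p}. \<bar>W j \<omega>\<bar> \<le> W 0 \<omega>}"
  have WD: "W 0 = D" by (simp add: W_def D_def)
  have [measurable]: "E \<in> events" "B \<in> events"
    unfolding E_def B_def by measurable
  have event: "{\<omega> \<in> space M. (INF lam\<in>{0..}. loss_p n p b1 (z \<omega>) lam) > (INF lam\<in>{0..}. loss_1 n b1 (z \<omega>) lam)} = E"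
    unfolding INF_loss_less_iff[OF n \<open>1 < p\<close> \<open>b1 \<noteq> 0\<close>] zD E_def b_def using zW by auto
  have "prob B = 1 / (2 * real p)"
    unfolding B_def W_def using \<open>1 < p\<close> uu prob_lin_max[of "{..<p}" 0 u] by simp
  \<comment> \<open>Up to a null set, \<open>{- b < D}\<close> is the disjoint union of
    \<open>E\<close> and \<open>B\<close>.\<close>
  moreover have "prob {\<omega> \<in> space M. - b < D \<omega>} = prob (E \<union> B)"
  proof (rule measure_eq_AE)
    \<comment> \<open>Column 1 exists as \<open>1 < p\<close>. Outside \<open>E\<close> the bound
      \<open>|W 1| \<le> max D 0\<close> then forces \<open>D\<close> to be positive, which rules
      out the degenerate case of a nonpositive \<open>D\<close> with all other \<open>W j\<close>
      zero.\<close>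
    have "AE \<omega> in M. W 1 \<omega> \<noteq> 0"
      unfolding W_def using uu[of 1 1] \<open>1 < p\<close> by (intro AE_lin_neq) (simp add: power2_eq_square)
    then show "AE \<omega> in M. \<omega> \<in> {\<omega> \<in> space M. - b < D \<omega>} \<longleftrightarrow> \<omega> \<in> E \<union> B"
    proof eventually_elim
      case (elim \<omega>)
      have "0 < b" using \<open>b1 \<noteq> 0\<close> by (simp add: b_def)
      have "- b < D \<omega>" if "\<omega> \<in> B"
        using that \<open>1 < p\<close> \<open>0 < b\<close> unfolding B_def WD by (force dest: bspec[of _ _ 1])
      moreover have "\<omega> \<in> B" if "\<omega> \<in> space M" "- b < D \<omega>" "\<omega> \<notin> E"
      proof -
        have le: "\<bar>W j \<omega>\<bar> \<le> max (D \<omega>) 0" if "j \<in> {1..<p}" for j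
          using that \<open>\<omega> \<in> space M\<close> \<open>- b < D \<omega>\<close> \<open>\<omega> \<notin> E\<close> by (force simp: E_def)
        from le[of 1] elim \<open>1 < p\<close> have "0 < D \<omega>" by (auto simp: max_def split: if_splits)
        have "\<bar>W j \<omega>\<bar> \<le> D \<omega>" if "j < p" for j
          using le[of j] that \<open>0 < D \<omega>\<close> WD by (cases "j = 0") auto
        then show ?thesis using \<open>\<omega> \<in> space M\<close> by (simp add: B_def WD)
      qed
      ultimately show ?case by (auto simp: E_def B_def)
    qed
  qed measurable
  moreover have "prob (E \<union> B) = prob E + prob B"
  proof (rule finite_measure_Union)
    show "E \<inter> B = {}" unfolding E_def B_def WD by (force simp: not_less)
  qed measurable
  moreover have "prob {\<omega> \<in> space M. - b < D \<omega>} = std_normal_cdf (b / \<sigma>)"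
  proof (rule prob_normal_gt_eq_cdf[OF _ \<open>\<sigma> > 0\<close>])
    have "(\<Sum>i<n. (u 0 i)\<^sup>2) = 1" using uu[of 0 0] \<open>1 < p\<close> by (simp add: power2_eq_square)
    then show "distributed M lborel D (normal_density 0 \<sigma>)"
      unfolding D_def using distributed_lin[of "u 0"] by simp
  qed
  ultimately have "prob E = std_normal_cdf (\<bar>b1\<bar> / \<sigma>) - 1 / (2 * real p)"
    by (simp add: b_def)
  then show ?thesis
    unfolding Let_def event[unfolded z_def] .
qed

end
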